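(* Let $X$ be an infinite-dimensional separable real Banach space whose dual $X^*$ has Property($K^*$). Then $$R(X) \leq 1 + \frac{1}{1 + r_{X^*}(1)}.$$
   Context: For a Banach space $Y$, $B_Y = \{y \in Y : \|y\| \leq 1\}$ denotes the closed unit ball. Weak convergence is denoted $\rightharpoonup$ and weak* convergence in $X^*$ (with respect to the predual $X$) is denoted $\stackrel{*}{\rightharpoonup}$. The coefficient $R(X)$ is $$R(X) = \sup\left\{ \liminf_{n\to\infty} \|x_n + x\| : x_n \in B_X \text{ for all } n,\ x_n \rightharpoonup 0,\ x \in B_X \right\}.$$ Property($K^*$): $X^*$ has Property($K^*$) if there exists $K \in [0,1)$ such that whenever $(x_n^* )$ is a sequence in $B_{X^*}$ and $x^* \in X^*$ satisfy $x_n^* \stackrel{*}{\rightharpoonup} 0$, $\lim_{n\to\infty}\|x_n^*\| = 1$ and $\liminf_{n\to\infty}\|x_n^* - x^*\| \leq 1$, then $\|x^*\| \leq K$. Opial's modulus of the dual $X^*$ (taken with respect to weak* null sequences) is, for $c \geq 0$, $$r_{X^*}(c) = \inf\left\{ \liminf_{n\to\infty}\|x_n^* - x^*\| - 1 : x^* \in X^*,\ \|x^*\| \geq c,\ (x_n^* ) \subset X^*,\ x_n^* \stackrel{*}{\rightharpoonup} 0,\ \liminf_{n\to\infty}\|x_n^*\| \geq 1 \right\}.$$ *)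

theory Defs
  imports "HOL-Analysis.Analysis"
begin

text \<open>The dual of \<open>X = 'a\<close> is the library type \<open>'a \<Rightarrow>\<^sub>L real\<close> of bounded linear functionals
  with the operator norm. Suprema, infima and lower limits are taken in \<open>ereal\<close>, so that
  they always exist; no junk value occurs for unbounded or empty sets.\<close>

definition weakly_tendsto :: "(nat \<Rightarrow> 'a::real_normed_vector) \<Rightarrow> 'a \<Rightarrow> bool" where
  "weakly_tendsto xs x \<longleftrightarrow>
     (\<forall>f :: 'a \<Rightarrow>\<^sub>L real. (\<lambda>n. blinfun_apply f (xs n)) \<longlonglongrightarrow> blinfun_apply f x)"

definition weak_star_tendsto ::
    "(nat \<Rightarrow> 'a::real_normed_vector \<Rightarrow>\<^sub>L real) \<Rightarrow> ('a \<Rightarrow>\<^sub>L real) \<Rightarrow> bool" where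
  "weak_star_tendsto fs f \<longleftrightarrow>
     (\<forall>x. (\<lambda>n. blinfun_apply (fs n) x) \<longlonglongrightarrow> blinfun_apply f x)"

definition R_coeff :: "'a::real_normed_vector itself \<Rightarrow> ereal" where
  "R_coeff _ = Sup {liminf (\<lambda>n. ereal (norm (xs n + x))) | (xs :: nat \<Rightarrow> 'a) x.
     (\<forall>n. xs n \<in> cball 0 1) \<and> weakly_tendsto xs 0 \<and> x \<in> cball 0 1}"

text \<open>The next two notions concern the dual of \<open>'a\<close>, but depend on the predual \<open>'a\<close> through
  weak* convergence; hence they are indexed by \<open>'a\<close>.\<close>

definition dual_property_K_star :: "'a::real_normed_vector itself \<Rightarrow> bool" where
  "dual_property_K_star _ \<longleftrightarrow>
     (\<exists>K::real. 0 \<le> K \<and> K < 1 \<and>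
       (\<forall>(fs :: nat \<Rightarrow> 'a \<Rightarrow>\<^sub>L real) (f :: 'a \<Rightarrow>\<^sub>L real).
          (\<forall>n. fs n \<in> cball 0 1) \<longrightarrow>
          weak_star_tendsto fs 0 \<longrightarrow>
          (\<lambda>n. norm (fs n)) \<longlonglongrightarrow> 1 \<longrightarrow>
          liminf (\<lambda>n. ereal (norm (fs n - f))) \<le> 1 \<longrightarrow>
          norm f \<le> K))"

definition dual_opial_modulus :: "'a::real_normed_vector itself \<Rightarrow> real \<Rightarrow> ereal" where
  "dual_opial_modulus _ c =
     Inf {liminf (\<lambda>n. ereal (norm (fs n - f))) - 1 |
            (f :: 'a \<Rightarrow>\<^sub>L real) (fs :: nat \<Rightarrow> 'a \<Rightarrow>\<^sub>L real).
          norm f \<ge> c \<and> weak_star_tendsto fs 0 \<and>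
          liminf (\<lambda>n. ereal (norm (fs n))) \<ge> 1}"

end

theory Submission
  imports Defs "HOL-Complex_Analysis.Great_Picard"
begin

text \<open>
  Let \<open>c < liminf \<parallel>x\<^sub>n + x\<parallel>\<close> with \<open>a = c - 1 > 0\<close>, and let \<open>f\<^sub>n\<close> be a functional of norm at most 1
  with \<open>f\<^sub>n (x\<^sub>n + x) = \<parallel>x\<^sub>n + x\<parallel>\<close>. After passing to a subsequence, \<open>f\<^sub>n\<close> converges weak* to some
  \<open>f\<close>, as \<open>X\<close> is separable. Evaluating at \<open>x\<^sub>n + x\<close> gives both \<open>\<parallel>f\<parallel> \<ge> a\<close> and
  \<open>liminf \<parallel>f\<^sub>n - f\<parallel> \<ge> a\<close>, so the definition of Opial's modulus applies to the weak* null sequence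
  \<open>(f\<^sub>n - f) / a\<close> and the functional \<open>- f / a\<close>. It yields
  \<open>1 + r(1) \<le> liminf \<parallel>f\<^sub>n\<parallel> / a \<le> 1 / a\<close>, that is \<open>c \<le> 1 + 1 / (1 + r(1))\<close>.
\<close>

section \<open>Norming functionals\<close>

text \<open>Scaling is stated as an inequality because that form passes directly to infima; equality
  is recovered in \<open>sublinear_scaleR\<close> by scaling back with
  \<open>inverse c\<close>.\<close>

definition sublinear :: "('a::real_vector \<Rightarrow> real) \<Rightarrow> bool" where
  "sublinear p \<longleftrightarrow>
     (\<forall>x y. p (x + y) \<le> p x + p y) \<and> (\<forall>c x. 0 \<le> c \<longrightarrow> p (c *\<^sub>R x) \<le> c * p x)"

lemma sublinearI:
  assumes "\<And>x y. p (x + y) \<le> p x + p y"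
    and "\<And>c x. 0 \<le> c \<Longrightarrow> p (c *\<^sub>R x) \<le> c * p x"
  shows "sublinear p"
  using assms by (simp add: sublinear_def)

lemma sublinear_add: "sublinear p \<Longrightarrow> p (x + y) \<le> p x + p y"
  by (simp add: sublinear_def)

lemma sublinear_scaleR_le: "sublinear p \<Longrightarrow> 0 \<le> c \<Longrightarrow> p (c *\<^sub>R x) \<le> c * p x"
  by (simp add: sublinear_def)

lemma sublinear_zero:
  assumes "sublinear p"
  shows "p 0 = 0"
  using sublinear_add[OF assms, of 0 0] sublinear_scaleR_le[OF assms, of 0 0] by simp

lemma sublinear_scaleR:
  assumes "sublinear p" "0 \<le> c"
  shows "p (c *\<^sub>R x) = c * p x"
proof (cases "c = 0")
  case True
  then show ?thesis by (simp add: sublinear_zero[OF assms(1)])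
next
  case False
  with assms have "c > 0" by simp
  have "p x \<le> inverse c * p (c *\<^sub>R x)"
    using sublinear_scaleR_le[OF assms(1), of "inverse c" "c *\<^sub>R x"] \<open>c > 0\<close> by simp
  then have "c * p x \<le> p (c *\<^sub>R x)"
    using \<open>c > 0\<close> by (simp add: field_simps)
  with sublinear_scaleR_le[OF assms] show ?thesis by (simp add: antisym)
qed

lemma sublinear_ge_minus:
  assumes "sublinear p"
  shows "- p (- x) \<le> p x"
  using sublinear_add[OF assms, of x "- x"] sublinear_zero[OF assms] by simp

lemma sublinear_norm: "sublinear (norm :: 'a::real_normed_vector \<Rightarrow> real)"
  by (rule sublinearI) (auto simp: norm_triangle_ineq)

text \<open>Serves both infima of the Hahn-Banach argument: over the parameter of
  \<open>sublinear_tilt\<close> and over a chain in Zorn's lemma. The index \<open>k\<close> may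
  differ from \<open>i\<close> and \<open>j\<close>, since only the infimum has to be sublinear, not
  each \<open>f i\<close>.\<close>

lemma sublinear_INF:
  fixes f :: "'i \<Rightarrow> 'a::real_vector \<Rightarrow> real"
  assumes ne: "I \<noteq> {}"
    and bdd: "\<And>x. bdd_below ((\<lambda>i. f i x) ` I)"
    and add: "\<And>i j. i \<in> I \<Longrightarrow> j \<in> I \<Longrightarrow> \<exists>k\<in>I. \<forall>x y. f k (x + y) \<le> f i x + f j y"
    and scale: "\<And>c i. 0 \<le> c \<Longrightarrow> i \<in> I \<Longrightarrow> \<exists>k\<in>I. \<forall>x. f k (c *\<^sub>R x) \<le> c * f i x"
  shows "sublinear (\<lambda>x. INF i\<in>I. f i x)"
proof (rule sublinearI)
  fix x y
  let ?u = "\<lambda>x. INF i\<in>I. f i x"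
  have le: "?u (x + y) \<le> f i x + f j y" if ij: "i \<in> I" "j \<in> I" for i j
  proof -
    obtain k where "k \<in> I" "f k (x + y) \<le> f i x + f j y"
      using add[OF ij] by blast
    then show ?thesis using cINF_lower[OF bdd \<open>k \<in> I\<close>, of "x + y"] by simp
  qed
  \<comment> \<open>The infimum is taken over \<open>i\<close> with \<open>j\<close> fixed, and only
    then over \<open>j\<close>.\<close>
  have "?u (x + y) - f j y \<le> ?u x" if "j \<in> I" for j
    by (rule cINF_greatest[OF ne]) (use le[OF _ that] in \<open>simp add: algebra_simps\<close>)
  then have "?u (x + y) - ?u x \<le> ?u y"
    by (intro cINF_greatest[OF ne]) (force simp: algebra_simps)
  then show "?u (x + y) \<le> ?u x + ?u y" by simp
next
  fix c :: real and x
  assume c: "0 \<le> c"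
  let ?u = "\<lambda>x. INF i\<in>I. f i x"
  have le: "?u (c *\<^sub>R x) \<le> c * f i x" if i: "i \<in> I" for i
  proof -
    obtain k where "k \<in> I" "f k (c *\<^sub>R x) \<le> c * f i x"
      using scale[OF c i] by blast
    then show ?thesis using cINF_lower[OF bdd \<open>k \<in> I\<close>, of "c *\<^sub>R x"] by simp
  qed
  show "?u (c *\<^sub>R x) \<le> c * ?u x"
  proof (cases "c = 0")
    case True
    then show ?thesis using le ne by auto
  next
    case False
    with c have "c > 0" by simp
    then have "?u (c *\<^sub>R x) / c \<le> ?u x"
      by (intro cINF_greatest[OF ne]) (use le in \<open>simp add: field_simps\<close>)
    then show ?thesis using \<open>c > 0\<close> by (simp add: field_simps)
  qed
qed

text \<open>The functional \<open>q\<close> is the infimum over \<open>t \<ge> 0\<close> of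
  \<open>p (x + t *\<^sub>R y) - t * p y\<close>. The last bound forces
  \<open>q (- y) \<le> - p y\<close>, so anything linear below \<open>q\<close> is at least
  \<open>p y\<close> at \<open>y\<close>.\<close>

lemma sublinear_tilt:
  fixes p :: "'a::real_vector \<Rightarrow> real"
  assumes p: "sublinear p"
  obtains q where "sublinear q" "\<And>x. q x \<le> p x" "\<And>x. q x \<le> p (x + y) - p y"
proof
  let ?f = "\<lambda>t x. p (x + t *\<^sub>R y) - t * p y"
  have bdd: "bdd_below ((\<lambda>t. ?f t x) ` {0..})" for x
  proof (rule bdd_belowI2)
    fix t :: real
    assume "t \<in> {0..}"
    \<comment> \<open>Homogeneity turns the subtracted term into a value of \<open>p\<close>, and
      subadditivity bounds it by \<open>p (x + t *\<^sub>R y) + p (- x)\<close>, uniformly in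
      \<open>t\<close>.\<close>
    then have "t * p y = p (t *\<^sub>R y)" using sublinear_scaleR[OF p] by simp
    then show "- p (- x) \<le> ?f t x"
      using sublinear_add[OF p, of "x + t *\<^sub>R y" "- x"] by simp
  qed
  show "sublinear (\<lambda>x. INF t\<in>{0..}. ?f t x)"
  proof (rule sublinear_INF[OF _ bdd])
    fix s t :: real
    assume st: "s \<in> {0..}" "t \<in> {0..}"
    have "?f (s + t) (x + z) \<le> ?f s x + ?f t z" for x z
      using sublinear_add[OF p, of "x + s *\<^sub>R y" "z + t *\<^sub>R y"] by (simp add: algebra_simps)
    with st show "\<exists>k\<in>{0..}. \<forall>x z. ?f k (x + z) \<le> ?f s x + ?f t z"
      by (intro bexI[of _ "s + t"]) auto
  next
    fix c t :: real
    assume ct: "0 \<le> c" "t \<in> {0..}"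
    have "?f (c * t) (c *\<^sub>R x) \<le> c * ?f t x" for x
      using sublinear_scaleR_le[OF p ct(1), of "x + t *\<^sub>R y"] by (simp add: algebra_simps)
    with ct show "\<exists>k\<in>{0..}. \<forall>x. ?f k (c *\<^sub>R x) \<le> c * ?f t x"
      by (intro bexI[of _ "c * t"]) auto
  qed simp
  \<comment> \<open>The two bounds are the members \<open>t = 0\<close> and \<open>t = 1\<close> of
    the family.\<close>
  show "(INF t\<in>{0..}. ?f t x) \<le> p x" for x
    using cINF_lower[OF bdd, of 0 x] by simp
  show "(INF t\<in>{0..}. ?f t x) \<le> p (x + y) - p y" for x
    using cINF_lower[OF bdd, of 1 x] by simp
qed

text \<open>Tilting \<open>q\<close> in direction \<open>y\<close> gives a sublinear functional
  below \<open>q\<close>, hence \<open>q\<close> itself by minimality; the tilt bound then reads as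
  superadditivity.\<close>

lemma minimal_sublinear_imp_linear:
  fixes q :: "'a::real_vector \<Rightarrow> real"
  assumes q: "sublinear q"
    and min: "\<And>q'. sublinear q' \<Longrightarrow> (\<And>x. q' x \<le> q x) \<Longrightarrow> q' = q"
  shows "linear q"
proof -
  have add: "q (x + y) = q x + q y" for x y
  proof -
    obtain q' where "sublinear q'" "\<And>x. q' x \<le> q x" "\<And>x. q' x \<le> q (x + y) - q y"
      using sublinear_tilt[OF q] by metis
    with min have "q x \<le> q (x + y) - q y" by metis
    then show ?thesis using sublinear_add[OF q, of x y] by simp
  qed
  have neg: "q (- x) = - q x" for x
    using add[of x "- x"] sublinear_zero[OF q] by simp
  have "q (c *\<^sub>R x) = c * q x" for c x
    using sublinear_scaleR[OF q, of c x] sublinear_scaleR[OF q, of "- c" x] neg[of "c *\<^sub>R x"]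
    by (cases "0 \<le> c") simp_all
  with add show ?thesis by (intro linearI) auto
qed

text \<open>A form of the Hahn-Banach theorem: Zorn's lemma gives a minimal sublinear functional
  below \<open>p\<close>, and minimal ones are linear.\<close>

lemma sublinear_dominates_linear:
  fixes p :: "'a::real_vector \<Rightarrow> real"
  assumes p: "sublinear p"
  obtains f where "linear f" "\<And>x. f x \<le> p x"
proof -
  define A where "A = {q. sublinear q \<and> q \<le> p}"
  \<comment> \<open>The order is reversed, so that the maximal element from Zorn's lemma is a
    minimal functional and upper bounds of chains are pointwise infima.\<close>
  let ?P = "\<lambda>q q' :: 'a \<Rightarrow> real. q' \<le> q"
  have "\<exists>m\<in>A. \<forall>q\<in>A. q \<le> m \<longrightarrow> q = m"
  proof (rule predicate_Zorn)
    show "partial_order_on A (relation_of ?P A)"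
      by (rule partial_order_on_relation_ofI) auto
  next
    fix C
    assume C: "C \<in> Chains (relation_of ?P A)"
    then have CA: "C \<subseteq> A" and chain: "\<And>q q'. q \<in> C \<Longrightarrow> q' \<in> C \<Longrightarrow> q \<le> q' \<or> q' \<le> q"
      by (auto simp: Chains_def relation_of_def)
    show "\<exists>u\<in>A. \<forall>q\<in>C. u \<le> q"
    proof (cases "C = {}")
      case True
      then show ?thesis using p by (auto simp: A_def)
    next
      case False
      have bdd: "bdd_below ((\<lambda>q. q x) ` C)" for x
      proof (rule bdd_belowI2)
        fix q
        assume "q \<in> C"
        with CA have "sublinear q" "q (- x) \<le> p (- x)" by (auto simp: A_def le_fun_def)
        then show "- p (- x) \<le> q x" using sublinear_ge_minus[of q x] by simp
      qed
      let ?u = "\<lambda>x. INF q\<in>C. q x"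
      have "sublinear ?u"
      proof (rule sublinear_INF[OF False bdd])
        fix q q'
        assume qq': "q \<in> C" "q' \<in> C"
        \<comment> \<open>In a chain the smaller of \<open>q\<close> and \<open>q'\<close> lies
          below both.\<close>
        obtain k where k: "k \<in> C" "k \<le> q" "k \<le> q'"
          using chain[OF qq'] qq' by blast
        then have "sublinear k" using CA by (auto simp: A_def)
        then have "k (x + y) \<le> q x + q' y" for x y
          using sublinear_add[of k x y] k(2,3) by (force simp: le_fun_def intro: add_mono order_trans)
        with k(1) show "\<exists>k\<in>C. \<forall>x y. k (x + y) \<le> q x + q' y" by blast
      next
        fix c :: real and q
        assume "0 \<le> c" "q \<in> C"
        with CA show "\<exists>k\<in>C. \<forall>x. k (c *\<^sub>R x) \<le> c * q x"
          by (intro bexI[of _ q]) (auto simp: A_def intro: sublinear_scaleR_le)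
      qed
      moreover have lower: "?u \<le> q" if "q \<in> C" for q
        using cINF_lower[OF bdd that] by (simp add: le_fun_def)
      moreover have "?u \<le> p"
        using False CA lower by (auto simp: A_def intro: order_trans)
      ultimately show ?thesis by (auto simp: A_def)
    qed
  qed
  then obtain m where "m \<in> A" and min: "\<And>q. q \<in> A \<Longrightarrow> q \<le> m \<Longrightarrow> q = m" by blast
  then have m: "sublinear m" "m \<le> p" by (auto simp: A_def)
  have "q = m" if "sublinear q" "\<And>x. q x \<le> m x" for q
  proof -
    have "q \<le> m" using that(2) by (simp add: le_fun_def)
    moreover from this have "q \<in> A" using that(1) m(2) by (auto simp: A_def intro: order_trans)
    ultimately show ?thesis using min by blast
  qed
  then have "linear m" using minimal_sublinear_imp_linear[OF m(1)] by blast
  with m(2) that show thesis by (auto simp: le_fun_def)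
qed

text \<open>The norm is tilted in direction \<open>x\<close> before a linear functional is placed
  below it: domination by the norm gives the bound 1, and the tilt at \<open>- x\<close> gives the
  value at \<open>x\<close>.\<close>

lemma norming_functional:
  fixes x :: "'a::real_normed_vector"
  obtains f :: "'a \<Rightarrow>\<^sub>L real" where "norm f \<le> 1" "blinfun_apply f x = norm x"
proof -
  obtain q :: "'a \<Rightarrow> real" where q: "sublinear q" "\<And>z. q z \<le> norm z"
      "\<And>z. q z \<le> norm (z + x) - norm x"
    using sublinear_tilt[OF sublinear_norm] by metis
  obtain g where g: "linear g" "\<And>z. g z \<le> q z"
    using sublinear_dominates_linear[OF q(1)] by metis
  have le: "g z \<le> norm z" for z using g(2) q(2) order_trans by blast
  have abs_le: "\<bar>g z\<bar> \<le> norm z" for z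
    using le[of z] le[of "- z"] linear_neg[OF g(1), of z] by (simp add: abs_le_iff)
  have "g (- x) \<le> - norm x" using g(2)[of "- x"] q(3)[of "- x"] by simp
  then have gx: "g x = norm x" using le[of x] linear_neg[OF g(1), of x] by simp
  have bl: "bounded_linear g"
    by (intro bounded_linear_intro[of g 1])
      (use abs_le linear_add[OF g(1)] linear_scale[OF g(1)] in auto)
  show thesis
  proof (rule that[of "Blinfun g"])
    show "norm (Blinfun g) \<le> 1"
      by (rule norm_blinfun_bound) (use abs_le in \<open>simp_all add: bounded_linear_Blinfun_apply[OF bl]\<close>)
    show "blinfun_apply (Blinfun g) x = norm x"
      by (simp add: bounded_linear_Blinfun_apply[OF bl] gx)
  qed
qed

section \<open>Weak* sequential compactness\<close>

lemma abs_blinfun_apply_le: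
  fixes f :: "'a::real_normed_vector \<Rightarrow>\<^sub>L real"
  assumes "norm f \<le> 1"
  shows "\<bar>blinfun_apply f x\<bar> \<le> norm x"
  using norm_blinfun[of f x] mult_right_mono[OF assms, of "norm x"] by simp

text \<open>An \<open>e / 3\<close> argument: the uniform bound makes the \<open>fs n\<close>
  equicontinuous, so the Cauchy property spreads from \<open>D\<close> to its closure.\<close>

lemma pointwise_convergent_if_dense:
  fixes fs :: "nat \<Rightarrow> 'a::real_normed_vector \<Rightarrow>\<^sub>L real"
  assumes fs: "\<And>n. norm (fs n) \<le> 1"
    and D: "closure D = UNIV"
    and conv: "\<And>d. d \<in> D \<Longrightarrow> convergent (\<lambda>n. blinfun_apply (fs n) d)"
  shows "convergent (\<lambda>n. blinfun_apply (fs n) x)"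
proof -
  have "Cauchy (\<lambda>n. blinfun_apply (fs n) x)"
  proof (rule metric_CauchyI)
    fix e :: real
    assume "0 < e"
    moreover have "x \<in> closure D" using D by simp
    ultimately obtain d where d: "d \<in> D" "dist d x < e / 3"
      using closure_approachable[of x D] by (metis divide_pos_pos zero_less_numeral)
    obtain M where M: "\<And>m n. m \<ge> M \<Longrightarrow> n \<ge> M \<Longrightarrow>
        dist (blinfun_apply (fs m) d) (blinfun_apply (fs n) d) < e / 3"
      using metric_CauchyD[OF convergent_Cauchy[OF conv[OF d(1)]], of "e / 3"] \<open>0 < e\<close> by auto
    have close: "\<bar>blinfun_apply (fs n) x - blinfun_apply (fs n) d\<bar> < e / 3" for n
      using abs_blinfun_apply_le[OF fs, of n "x - d"] d(2)
      by (simp add: blinfun.diff_right dist_norm norm_minus_commute)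
    have "dist (blinfun_apply (fs m) x) (blinfun_apply (fs n) x) < e" if "m \<ge> M" "n \<ge> M" for m n
      using M[OF that] close[of m] close[of n] unfolding dist_real_def by arith
    then show "\<exists>M. \<forall>m\<ge>M. \<forall>n\<ge>M. dist (blinfun_apply (fs m) x) (blinfun_apply (fs n) x) < e"
      by blast
  qed
  then show ?thesis by (simp add: real_Cauchy_convergent)
qed

lemma pointwise_limit_functional:
  fixes fs :: "nat \<Rightarrow> 'a::real_normed_vector \<Rightarrow>\<^sub>L real"
  assumes fs: "\<And>n. norm (fs n) \<le> 1"
    and conv: "\<And>x. convergent (\<lambda>n. blinfun_apply (fs n) x)"
  obtains f where "weak_star_tendsto fs f"
proof -
  obtain g where g: "\<And>x. (\<lambda>n. blinfun_apply (fs n) x) \<longlonglongrightarrow> g x"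
    using conv unfolding convergent_def by metis
  have "bounded_linear g"
  proof (rule bounded_linear_intro)
    fix x y
    have "(\<lambda>n. blinfun_apply (fs n) (x + y)) \<longlonglongrightarrow> g x + g y"
      using tendsto_add[OF g g, of x y] by (simp add: blinfun.add_right)
    then show "g (x + y) = g x + g y" using g LIMSEQ_unique by blast
  next
    fix c x
    have "(\<lambda>n. blinfun_apply (fs n) (c *\<^sub>R x)) \<longlonglongrightarrow> c *\<^sub>R g x"
      using tendsto_scaleR[OF tendsto_const g, of c x] by (simp add: blinfun.scaleR_right)
    then show "g (c *\<^sub>R x) = c *\<^sub>R g x" using g LIMSEQ_unique by blast
  next
    fix x
    show "norm (g x) \<le> norm x * 1"
      by (rule Lim_bounded[OF tendsto_norm[OF g], of 0]) (use abs_blinfun_apply_le[OF fs] in simp)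
  qed
  then have "weak_star_tendsto fs (Blinfun g)"
    using g by (simp add: weak_star_tendsto_def bounded_linear_Blinfun_apply)
  then show thesis by (rule that)
qed

text \<open>Sequential Banach-Alaoglu: a diagonal subsequence converges on a countable dense set,
  hence everywhere by equicontinuity.\<close>

lemma weak_star_convergent_subsequence:
  fixes fs :: "nat \<Rightarrow> 'a::real_normed_vector \<Rightarrow>\<^sub>L real"
  assumes sep: "separable_space (euclidean :: 'a topology)"
    and fs: "\<And>n. norm (fs n) \<le> 1"
  obtains k f where "strict_mono (k :: nat \<Rightarrow> nat)" "weak_star_tendsto (fs \<circ> k) f"
proof -
  obtain D :: "'a set" where D: "countable D" "closure D = UNIV"
    using sep by (auto simp: separable_space_def)
  \<comment> \<open>\<open>function_convergent_subsequence\<close> wants one bound for all points, hence the rescaling of \<open>d\<close>.\<close>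
  let ?h = "\<lambda>n d. blinfun_apply (fs n) d / (1 + norm d)"
  have pos: "1 + norm d > 0" for d :: 'a by (simp add: add_pos_nonneg)
  have "norm (?h n d) \<le> 1" for n d
    using abs_blinfun_apply_le[OF fs, of n d] pos[of d] by (simp add: field_simps)
  then obtain k where k: "strict_mono (k :: nat \<Rightarrow> nat)"
      "\<And>d. d \<in> D \<Longrightarrow> \<exists>l. (\<lambda>n. ?h (k n) d) \<longlonglongrightarrow> l"
    using function_convergent_subsequence[OF D(1), of ?h 1] by blast
  have "convergent (\<lambda>n. blinfun_apply (fs (k n)) d)" if d: "d \<in> D" for d
  proof -
    obtain l where "(\<lambda>n. ?h (k n) d) \<longlonglongrightarrow> l" using k(2)[OF d] by blast
    from tendsto_mult_left[OF this, of "1 + norm d"] pos[of d] show ?thesis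
      by (auto simp: convergent_def)
  qed
  then have "convergent (\<lambda>n. blinfun_apply ((fs \<circ> k) n) x)" for x
    using pointwise_convergent_if_dense[of "fs \<circ> k" D x] fs D(2) by simp
  then obtain f where "weak_star_tendsto (fs \<circ> k) f"
    using pointwise_limit_functional[of "fs \<circ> k"] fs by auto
  with k(1) that show thesis by blast
qed

section \<open>The bound\<close>

text \<open>Norms have nonnegative lower limits. This keeps \<open>1 + r\<close> nonnegative, so its
  reciprocal in \<open>ereal\<close> is nonnegative too.\<close>

lemma dual_opial_modulus_ge_minus_1: "- 1 \<le> dual_opial_modulus TYPE('a::real_normed_vector) c"
  unfolding dual_opial_modulus_def
proof (rule Inf_greatest)
  fix z
  assume "z \<in> {liminf (\<lambda>n. ereal (norm (fs n - f))) - 1 | (f :: 'a \<Rightarrow>\<^sub>L real) fs.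
    norm f \<ge> c \<and> weak_star_tendsto fs 0 \<and> liminf (\<lambda>n. ereal (norm (fs n))) \<ge> 1}"
  then obtain f :: "'a \<Rightarrow>\<^sub>L real" and fs
    where z: "z = liminf (\<lambda>n. ereal (norm (fs n - f))) - 1" by blast
  have "0 \<le> liminf (\<lambda>n. ereal (norm (fs n - f)))" by (rule Liminf_bounded) simp
  then show "- 1 \<le> z"
    unfolding z by (cases "liminf (\<lambda>n. ereal (norm (fs n - f)))") (auto simp: one_ereal_def)
qed

text \<open>The null sequence \<open>e\<close> encodes that the lower limit of
  \<open>norm (fs n - f)\<close> is at least \<open>a\<close>, in a form that survives division by
  \<open>a\<close>.\<close>

lemma dual_opial_modulus_le:
  fixes fs :: "nat \<Rightarrow> 'a::real_normed_vector \<Rightarrow>\<^sub>L real"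
  assumes "a > 0" "weak_star_tendsto fs f" "\<And>n. norm (fs n) \<le> 1" "a \<le> norm f"
    and e: "e \<longlonglongrightarrow> 0" "\<And>n. a - e n \<le> norm (fs n - f)"
  shows "dual_opial_modulus TYPE('a) 1 \<le> ereal (1 / a - 1)"
proof -
  let ?gs = "\<lambda>n. (fs n - f) /\<^sub>R a" and ?g = "- (f /\<^sub>R a)"
  have "1 \<le> norm ?g" using assms(1,4) by (simp add: field_simps)
  moreover have "weak_star_tendsto ?gs 0"
    unfolding weak_star_tendsto_def
  proof
    fix x
    have "(\<lambda>n. blinfun_apply (fs n) x) \<longlonglongrightarrow> blinfun_apply f x"
      using assms(2) by (simp add: weak_star_tendsto_def)
    then have "(\<lambda>n. inverse a *\<^sub>R (blinfun_apply (fs n) x - blinfun_apply f x)) \<longlonglongrightarrow>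
        inverse a *\<^sub>R (blinfun_apply f x - blinfun_apply f x)"
      by (intro tendsto_scaleR tendsto_diff tendsto_const)
    then show "(\<lambda>n. blinfun_apply (?gs n) x) \<longlonglongrightarrow> blinfun_apply 0 x"
      by (simp add: blinfun.diff_left blinfun.scaleR_left)
  qed
  moreover have "1 \<le> liminf (\<lambda>n. ereal (norm (?gs n)))"
  proof -
    have "(\<lambda>n. 1 - e n / a) \<longlonglongrightarrow> 1 - 0 / a"
      using assms(1) by (intro tendsto_intros e) auto
    then have "liminf (\<lambda>n. ereal (1 - e n / a)) = 1"
      by (intro lim_imp_Liminf) (simp_all add: one_ereal_def)
    moreover have "1 - e n / a \<le> norm (?gs n)" for n
    proof -
      have "1 - e n / a = (a - e n) / a" using assms(1) by (simp add: diff_divide_distrib)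
      also have "\<dots> \<le> norm (fs n - f) / a" using e(2) assms(1) by (simp add: divide_right_mono)
      also have "\<dots> = norm (?gs n)" using assms(1) by (simp add: divide_inverse mult.commute)
      finally show ?thesis .
    qed
    then have "liminf (\<lambda>n. ereal (1 - e n / a)) \<le> liminf (\<lambda>n. ereal (norm (?gs n)))"
      by (intro Liminf_mono) simp
    ultimately show ?thesis by simp
  qed
  ultimately have "dual_opial_modulus TYPE('a) 1 \<le> liminf (\<lambda>n. ereal (norm (?gs n - ?g))) - 1"
    unfolding dual_opial_modulus_def
    by (intro Inf_lower CollectI exI[of _ ?g] exI[of _ ?gs] conjI refl)
  moreover have "liminf (\<lambda>n. ereal (norm (?gs n - ?g))) \<le> ereal (1 / a)"
  proof -
    \<comment> \<open>The sign of \<open>?g\<close> is chosen so that \<open>f\<close> cancels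
      here.\<close>
    have "?gs n - ?g = fs n /\<^sub>R a" for n by (simp add: algebra_simps)
    then have "norm (?gs n - ?g) \<le> 1 / a" for n
      using assms(1) assms(3)[of n] by (simp add: divide_simps)
    then have "liminf (\<lambda>n. ereal (norm (?gs n - ?g))) \<le> liminf (\<lambda>n. ereal (1 / a))"
      by (intro Liminf_mono) simp
    then show ?thesis by (simp add: Liminf_const)
  qed
  then have "liminf (\<lambda>n. ereal (norm (?gs n - ?g))) - 1 \<le> ereal (1 / a) - 1"
    by (rule ereal_minus_mono) simp
  ultimately show ?thesis by (simp add: one_ereal_def)
qed

text \<open>Of the value \<open>1 + a\<close> at \<open>xs n + x\<close>, the part at
  \<open>xs n\<close> is at most 1, so at least \<open>a\<close> is left at \<open>x\<close>.
  Conversely the part at \<open>x\<close> is at most 1 in the limit, so at least about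
  \<open>a\<close> is left at \<open>xs n\<close>, where \<open>f\<close> is negligible.\<close>

lemma weak_star_limit_of_norming_functionals:
  fixes xs :: "nat \<Rightarrow> 'a::real_normed_vector" and fs :: "nat \<Rightarrow> 'a \<Rightarrow>\<^sub>L real"
  assumes xs: "weakly_tendsto xs 0" "\<And>n. norm (xs n) \<le> 1" and x: "norm x \<le> 1"
    and fs: "weak_star_tendsto fs f" "\<And>n. norm (fs n) \<le> 1"
    and ge: "\<And>n. 1 + a \<le> blinfun_apply (fs n) (xs n + x)"
  shows "a \<le> norm f"
    and "\<exists>e. e \<longlonglongrightarrow> 0 \<and> (\<forall>n. a - e n \<le> norm (fs n - f))"
proof -
  have fsx: "(\<lambda>n. blinfun_apply (fs n) x) \<longlonglongrightarrow> blinfun_apply f x"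
    using fs(1) by (simp add: weak_star_tendsto_def)
  have fxs: "(\<lambda>n. blinfun_apply f (xs n)) \<longlonglongrightarrow> 0"
    using xs(1) by (auto simp: weakly_tendsto_def)
  have "a \<le> blinfun_apply (fs n) x" for n
    using ge[of n] abs_blinfun_apply_le[OF fs(2), of n "xs n"] xs(2)[of n]
    by (simp add: blinfun.add_right)
  then have "a \<le> blinfun_apply f x" using Lim_bounded2[OF fsx, of 0] by blast
  also have "\<dots> \<le> norm f"
    using norm_blinfun[of f x] mult_left_mono[OF x, of "norm f"] by simp
  finally show "a \<le> norm f" .
  \<comment> \<open>The error of replacing \<open>fs n\<close> by \<open>f\<close> at
    \<open>x\<close> and by \<open>fs n - f\<close> at \<open>xs n\<close>; it vanishes by weak* and
    weak convergence respectively.\<close>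
  let ?e = "\<lambda>n. blinfun_apply (fs n) x - blinfun_apply f x + blinfun_apply f (xs n)"
  have "?e \<longlonglongrightarrow> 0"
    using tendsto_add[OF tendsto_diff[OF fsx tendsto_const[of "blinfun_apply f x"]] fxs] by simp
  moreover have "a - ?e n \<le> norm (fs n - f)" for n
  proof -
    have "blinfun_apply f x \<le> 1"
    proof (rule Lim_bounded[OF fsx, of 0], intro allI impI)
      show "blinfun_apply (fs n) x \<le> 1" for n
        using abs_blinfun_apply_le[OF fs(2), of n x] x by simp
    qed
    moreover have "blinfun_apply (fs n - f) (xs n) \<le> norm (fs n - f)"
      using norm_blinfun[of "fs n - f" "xs n"] mult_left_mono[OF xs(2)[of n], of "norm (fs n - f)"]
      by simp
    ultimately show ?thesis
      using ge[of n] by (simp add: blinfun.add_right blinfun.diff_left)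
  qed
  ultimately show "\<exists>e. e \<longlonglongrightarrow> 0 \<and> (\<forall>n. a - e n \<le> norm (fs n - f))" by blast
qed

lemma dual_opial_modulus_le_of_liminf:
  fixes xs :: "nat \<Rightarrow> 'a::real_normed_vector"
  assumes sep: "separable_space (euclidean :: 'a topology)"
    and xs: "weakly_tendsto xs 0" "\<And>n. norm (xs n) \<le> 1" and x: "norm x \<le> 1"
    and "a > 0" and less: "ereal (1 + a) < liminf (\<lambda>n. ereal (norm (xs n + x)))"
  shows "dual_opial_modulus TYPE('a) 1 \<le> ereal (1 / a - 1)"
proof -
  have "eventually (\<lambda>n. 1 + a < norm (xs n + x)) sequentially"
    using less_LiminfD[OF less] by simp
  then obtain N where N: "\<And>n. n \<ge> N \<Longrightarrow> 1 + a < norm (xs n + x)"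
    by (auto simp: eventually_sequentially)
  have "\<exists>f :: 'a \<Rightarrow>\<^sub>L real. norm f \<le> 1 \<and> blinfun_apply f (xs (n + N) + x) = norm (xs (n + N) + x)" for n
    using norming_functional by metis
  then obtain fs :: "nat \<Rightarrow> 'a \<Rightarrow>\<^sub>L real" where fs: "\<And>n. norm (fs n) \<le> 1"
      "\<And>n. blinfun_apply (fs n) (xs (n + N) + x) = norm (xs (n + N) + x)"
    by metis
  obtain k f where k: "strict_mono (k :: nat \<Rightarrow> nat)" and f: "weak_star_tendsto (fs \<circ> k) f"
    by (rule weak_star_convergent_subsequence[OF sep fs(1)])
  \<comment> \<open>The shift by \<open>N\<close> makes the strict lower bound hold for every index;
    \<open>k\<close> is the subsequence along which the functionals converge.\<close>
  let ?ys = "\<lambda>n. xs (k n + N)"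
  have "strict_mono (\<lambda>n. k n + N)" using k by (simp add: strict_mono_def)
  then have ys: "weakly_tendsto ?ys 0"
    using xs(1) LIMSEQ_subseq_LIMSEQ[where f = "\<lambda>n. k n + N"]
    unfolding weakly_tendsto_def comp_def by blast
  have ge: "1 + a \<le> blinfun_apply ((fs \<circ> k) n) (?ys n + x)" for n
    using N[of "k n + N"] fs(2)[of "k n"] by simp
  have bd: "norm ((fs \<circ> k) n) \<le> 1" for n using fs(1) by simp
  note * = weak_star_limit_of_norming_functionals[OF ys xs(2) x f bd ge]
  obtain e where "e \<longlonglongrightarrow> 0" "\<And>n. a - e n \<le> norm ((fs \<circ> k) n - f)" using *(2) by blast
  then show ?thesis by (rule dual_opial_modulus_le[OF \<open>a > 0\<close> f bd *(1)])
qed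

lemma le_one_plus_inverse_one_plus:
  fixes r :: ereal
  assumes "- 1 \<le> r" "a > 0" "r \<le> ereal (1 / a - 1)"
  shows "ereal (1 + a) \<le> 1 + 1 / (1 + r)"
proof (cases r)
  case (real s)
  with assms have s: "- 1 \<le> s" "1 + s \<le> 1 / a" by (auto simp: one_ereal_def)
  show ?thesis
  proof (cases "s = - 1")
    case True
    \<comment> \<open>in \<open>ereal\<close>, \<open>1 / 0 = \<infinity>\<close>\<close>
    then show ?thesis using real by (simp add: one_ereal_def divide_ereal_def zero_ereal_def[symmetric])
  next
    case False
    with s assms(2) have "a \<le> 1 / (1 + s)" by (simp add: field_simps)
    with False real show ?thesis by (simp add: one_ereal_def)
  qed
qed (use assms in \<open>auto simp: one_ereal_def\<close>)

theorem proposition3p1: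
  assumes infinite_dimensional: "\<not> (\<exists>B :: 'a::banach set. finite B \<and> span B = UNIV)"
    and separable: "separable_space (euclidean :: 'a topology)"
    and K_star: "dual_property_K_star TYPE('a)"
  shows "R_coeff TYPE('a) \<le> 1 + 1 / (1 + dual_opial_modulus TYPE('a) 1)"
  unfolding R_coeff_def
proof (rule Sup_least, clarify)
  let ?r = "dual_opial_modulus TYPE('a) 1"
  fix xs :: "nat \<Rightarrow> 'a" and x :: 'a
  assume xs: "\<forall>n. xs n \<in> cball 0 1" "weakly_tendsto xs 0" and x: "x \<in> cball 0 1"
  \<comment> \<open>Includes the extreme values: the quotient is \<open>\<infinity>\<close> for
    \<open>?r = - 1\<close> and 0 for \<open>?r = \<infinity>\<close>. It ensures below that
    \<open>c - 1\<close> is positive.\<close>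
  have "0 \<le> 1 / (1 + ?r)"
    using dual_opial_modulus_ge_minus_1[where 'a = 'a, of 1]
    by (cases ?r) (auto simp: one_ereal_def divide_ereal_def)
  then have one_le: "1 \<le> 1 + 1 / (1 + ?r)"
    using add_left_mono[of 0 "1 / (1 + ?r)" 1] by simp
  show "liminf (\<lambda>n. ereal (norm (xs n + x))) \<le> 1 + 1 / (1 + ?r)"
  proof (rule ccontr)
    assume "\<not> ?thesis"
    \<comment> \<open>A real number strictly between the two sides gives a finite
      \<open>a = c - 1\<close>, even if a side is infinite.\<close>
    then obtain c where c: "1 + 1 / (1 + ?r) < ereal c"
        "ereal c < liminf (\<lambda>n. ereal (norm (xs n + x)))"
      using ereal_dense2 by (metis not_le)
    have "1 < ereal c" using one_le c(1) by (rule le_less_trans)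
    then have "0 < c - 1" by (simp add: one_ereal_def)
    moreover have "?r \<le> ereal (1 / (c - 1) - 1)"
      using dual_opial_modulus_le_of_liminf[OF separable xs(2) _ _ \<open>0 < c - 1\<close>, of x] xs(1) x c(2)
      by simp
    ultimately have "ereal (1 + (c - 1)) \<le> 1 + 1 / (1 + ?r)"
      by (intro le_one_plus_inverse_one_plus dual_opial_modulus_ge_minus_1)
    with c(1) show False by simp
  qed
qed

end
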